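(* Suppose that $m,n\ge 2$. Let $\mathcal{A},\mathcal{B}\in CP_{m,n}$. Then: (i) $\mathcal{A}\circ\mathcal{B}\in CP_{m,n}$. (ii) If $\mathcal{A}\in SCP_{m,n}$ and every diagonal entry of $\mathcal{B}$ is positive, then $\mathcal{A}\circ\mathcal{B}\in SCP_{m,n}$. (iii) If $\mathcal{A},\mathcal{B}\in SCP_{m,n}$, then $\mathcal{A}\circ\mathcal{B}\in SCP_{m,n}$.
   Context: $S_{m,n}$ is the space of real symmetric tensors of order $m$ and dimension $n$. For $\mathbf{u}\in\mathbb{R}^n$, $\mathbf{u}^m\in S_{m,n}$ is the rank-one tensor with entries $u_{i_1}\cdots u_{i_m}$; $\mathbb{R}^n_+$ is the nonnegative orthant. A tensor $\mathcal{A}\in S_{m,n}$ is completely positive (in $CP_{m,n}$) if $\mathcal{A}=\sum_{j=1}^p\mathbf{u}_j^m$ for finitely many $\mathbf{u}_j\in\mathbb{R}^n_+$; it is strongly completely positive (in $SCP_{m,n}$) if such a representation with $\mathbf{u}_j\in\mathbb{R}^n_+$ exists with $\mathbf{u}_1,\dots,\mathbf{u}_p$ spanning $\mathbb{R}^n$. $\mathcal{A}\circ\mathcal{B}$ denotes the Hadamard (entrywise) product. The diagonal entries of $\mathcal{B}=(b_{i_1\cdots i_m})$ are $b_{i i\cdots i}$, $i=1,\dots,n$. *)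

theory Defs
  imports "HOL-Analysis.Analysis"
begin

text \<open>
  The order of a tensor is \<open>m = CARD('m)\<close> and its dimension is \<open>n = CARD('n)\<close>. A multi-index
  \<open>(i\<^sub>1, \<dots>, i\<^sub>m)\<close> is a function \<open>i :: 'm \<Rightarrow> 'n\<close> from the \<open>m\<close> positions to the \<open>n\<close> coordinates,
  and a tensor is the vector of its \<open>n ^ m\<close> entries.
\<close>
type_synonym ('m, 'n) tensor = "(real, 'm \<Rightarrow> 'n) vec"

definition symmetric_tensors :: "('m::finite, 'n::finite) tensor set" where
  "symmetric_tensors = {A. \<forall>\<pi> i. \<pi> permutes UNIV \<longrightarrow> A $ (i \<circ> \<pi>) = A $ i}"

definition nonneg_orthant :: "(real ^ 'n::finite) set" where
  "nonneg_orthant = {x. \<forall>k. 0 \<le> x $ k}"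

definition tensor_power :: "real ^ 'n::finite \<Rightarrow> ('m::finite, 'n) tensor" where
  "tensor_power u = (\<chi> i. \<Prod>k\<in>UNIV. u $ i k)"

definition hadamard :: "('m::finite, 'n::finite) tensor \<Rightarrow> ('m, 'n) tensor \<Rightarrow> ('m, 'n) tensor"
    (infixl "\<circ>\<^sub>H" 70) where
  "A \<circ>\<^sub>H B = (\<chi> i. A $ i * B $ i)"

definition diagonal_entry :: "('m::finite, 'n::finite) tensor \<Rightarrow> 'n \<Rightarrow> real" where
  "diagonal_entry A k = A $ (\<lambda>_. k)"

definition CP :: "('m::finite, 'n::finite) tensor set" where
  "CP = {A \<in> symmetric_tensors. \<exists>(p::nat) u.
    (\<forall>j\<in>{1..p}. u j \<in> nonneg_orthant) \<and>
    A = (\<Sum>j=1..p. tensor_power (u j))}"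

definition SCP :: "('m::finite, 'n::finite) tensor set" where
  "SCP = {A \<in> symmetric_tensors. \<exists>(p::nat) u.
    (\<forall>j\<in>{1..p}. u j \<in> nonneg_orthant) \<and>
    A = (\<Sum>j=1..p. tensor_power (u j)) \<and>
    span (u ` {1..p}) = UNIV}"

end

theory Submission
  imports Defs
begin

text \<open>
  The Hadamard product is bilinear, and on rank-one tensors it multiplies the generating vectors
  componentwise (\<open>hadamard_tensor_power\<close>). Hence if \<open>A = \<Sum>\<^sub>j u\<^sub>j\<^sup>m\<close> and \<open>B = \<Sum>\<^sub>l v\<^sub>l\<^sup>m\<close>, then
  \<open>A \<circ>\<^sub>H B = \<Sum>\<^sub>j\<^sub>,\<^sub>l (u\<^sub>j * v\<^sub>l)\<^sup>m\<close>, and the products \<open>u\<^sub>j * v\<^sub>l\<close> are again nonnegative. This is (i).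

  For (ii), let \<open>x\<close> be orthogonal to every \<open>u\<^sub>j * v\<^sub>l\<close>. Componentwise multiplication is self-adjoint,
  so \<open>x * v\<^sub>l\<close> is orthogonal to every \<open>u\<^sub>j\<close>; as the \<open>u\<^sub>j\<close> span, \<open>x * v\<^sub>l = 0\<close> for all \<open>l\<close>. The diagonal
  entry of \<open>B\<close> at \<open>k\<close> is \<open>\<Sum>\<^sub>l (v\<^sub>l)\<^sub>k\<^sup>m\<close>, so if it is nonzero then some \<open>v\<^sub>l\<close> has a nonzero \<open>k\<close>-th
  component, which forces \<open>x\<^sub>k = 0\<close>. Thus \<open>x = 0\<close> and the products span
  (\<open>span_componentwise_products\<close>).

  Part (iii) reduces to (ii): vectors that span cannot all have a vanishing \<open>k\<close>-th component, so the
  diagonal entries of a strongly completely positive tensor are positive (\<open>SCP_diagonal_pos\<close>).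
\<close>

lemma tensor_power_symmetric: "tensor_power u \<in> symmetric_tensors"
proof -
  have "(\<Prod>k\<in>UNIV. u $ (i (\<pi> k))) = (\<Prod>k\<in>UNIV. u $ (i k))"
    if "\<pi> permutes UNIV" for \<pi> :: "'m::finite \<Rightarrow> 'm" and i
    using prod.permute[OF that, of "\<lambda>k. u $ (i k)"] by (simp add: o_def)
  then show ?thesis
    by (auto simp: symmetric_tensors_def tensor_power_def)
qed

lemma symmetric_tensors_sum:
  assumes "\<And>j. j \<in> I \<Longrightarrow> T j \<in> symmetric_tensors"
  shows "(\<Sum>j\<in>I. T j) \<in> symmetric_tensors"
  using assms by (auto simp: symmetric_tensors_def intro!: sum.cong)

lemma reindex_from_one:
  assumes "finite I"
  obtains p :: nat and h where "bij_betw h {1..p} I"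
  using ex_bij_betw_nat_finite_1[OF assms] by blast

text \<open>
  Arbitrary finite index sets are allowed here because the Hadamard product of two representations
  is naturally indexed by pairs.
\<close>
lemma CP_I:
  fixes u :: "'i \<Rightarrow> real ^ 'n::finite"
  assumes "finite I" and "\<And>j. j \<in> I \<Longrightarrow> u j \<in> nonneg_orthant"
  shows "(\<Sum>j\<in>I. tensor_power (u j)) \<in> (CP :: ('m::finite, 'n) tensor set)"
    (is "?S \<in> _")
proof -
  obtain p :: nat and h where h: "bij_betw h {1..p} I"
    using reindex_from_one[OF assms(1)] .
  have "?S = (\<Sum>j=1..p. tensor_power ((u \<circ> h) j))"
    using sum.reindex_bij_betw[OF h, of "\<lambda>j. tensor_power (u j) :: ('m, 'n) tensor"]
    by (simp add: o_def)
  moreover have "\<forall>j\<in>{1..p}. (u \<circ> h) j \<in> nonneg_orthant"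
    using h assms(2) by (auto simp: bij_betw_def)
  moreover have "?S \<in> symmetric_tensors"
    by (intro symmetric_tensors_sum tensor_power_symmetric)
  ultimately show ?thesis
    unfolding CP_def by blast
qed

lemma SCP_I:
  fixes u :: "'i \<Rightarrow> real ^ 'n::finite"
  assumes "finite I" and "\<And>j. j \<in> I \<Longrightarrow> u j \<in> nonneg_orthant" and "span (u ` I) = UNIV"
  shows "(\<Sum>j\<in>I. tensor_power (u j)) \<in> (SCP :: ('m::finite, 'n) tensor set)"
    (is "?S \<in> _")
proof -
  obtain p :: nat and h where h: "bij_betw h {1..p} I"
    using reindex_from_one[OF assms(1)] .
  have "?S = (\<Sum>j=1..p. tensor_power ((u \<circ> h) j))"
    using sum.reindex_bij_betw[OF h, of "\<lambda>j. tensor_power (u j) :: ('m, 'n) tensor"]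
    by (simp add: o_def)
  moreover have "\<forall>j\<in>{1..p}. (u \<circ> h) j \<in> nonneg_orthant"
    using h assms(2) by (auto simp: bij_betw_def)
  moreover have "span ((u \<circ> h) ` {1..p}) = UNIV"
    using bij_betw_imp_surj_on[OF h] assms(3) by (simp only: image_comp[symmetric])
  moreover have "?S \<in> symmetric_tensors"
    by (intro symmetric_tensors_sum tensor_power_symmetric)
  ultimately show ?thesis
    unfolding SCP_def by blast
qed

lemma CP_E:
  assumes "A \<in> CP"
  obtains p :: nat and u where "\<forall>j\<in>{1..p}. u j \<in> nonneg_orthant"
    and "A = (\<Sum>j=1..p. tensor_power (u j))"
  using assms unfolding CP_def by blast

lemma SCP_E:
  assumes "A \<in> SCP"
  obtains p :: nat and u where "\<forall>j\<in>{1..p}. u j \<in> nonneg_orthant"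
    and "A = (\<Sum>j=1..p. tensor_power (u j))" and "span (u ` {1..p}) = UNIV"
  using assms unfolding SCP_def by blast

lemma nonneg_orthant_mult:
  "u \<in> nonneg_orthant \<Longrightarrow> v \<in> nonneg_orthant \<Longrightarrow> u * v \<in> nonneg_orthant"
  by (simp add: nonneg_orthant_def)

lemma hadamard_tensor_power: "tensor_power u \<circ>\<^sub>H tensor_power v = tensor_power (u * v)"
  by (simp add: hadamard_def tensor_power_def prod.distrib)

lemma hadamard_sum:
  "(\<Sum>j\<in>I. S j) \<circ>\<^sub>H (\<Sum>l\<in>J. T l) = (\<Sum>(j, l)\<in>I \<times> J. S j \<circ>\<^sub>H T l)"
  by (simp add: hadamard_def vec_eq_iff sum_product sum.cartesian_product case_prod_beta)

lemma hadamard_sum_tensor_power: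
  "(\<Sum>j\<in>I. tensor_power (u j)) \<circ>\<^sub>H (\<Sum>l\<in>J. tensor_power (v l))
    = (\<Sum>q\<in>I \<times> J. tensor_power (u (fst q) * v (snd q)))"
  by (simp add: hadamard_sum hadamard_tensor_power case_prod_beta)

lemma diagonal_entry_sum_tensor_power:
  "diagonal_entry (\<Sum>j\<in>I. tensor_power (u j) :: ('m::finite, 'n::finite) tensor) k
    = (\<Sum>j\<in>I. (u j $ k) ^ CARD('m))"
  by (simp add: diagonal_entry_def tensor_power_def)

lemma inner_mult_vec_left: "inner (x * v) u = inner x (u * v)" for x :: "real ^ 'n::finite"
  by (simp add: inner_vec_def mult_ac)

text \<open>
  By \<open>nonzero\<close>, the diagonal matrices with diagonals \<open>v \<in> V\<close> have no common kernel vector other than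
  zero. They are self-adjoint, so their ranges together span, and each range is spanned by the image
  of \<open>U\<close>.
\<close>
lemma span_componentwise_products:
  fixes U V :: "(real ^ 'n::finite) set"
  assumes "span U = UNIV" and nonzero: "\<And>k. \<exists>v\<in>V. v $ k \<noteq> 0"
  shows "span ((\<lambda>(u, v). u * v) ` (U \<times> V)) = UNIV"
proof (rule ccontr)
  assume "span ((\<lambda>(u, v). u * v) ` (U \<times> V)) \<noteq> UNIV"
  then obtain x where "x \<noteq> 0"
    and "\<forall>y\<in>span ((\<lambda>(u, v). u * v) ` (U \<times> V)). inner x y = 0"
    using span_not_UNIV_orthogonal by blast
  then have orth: "inner (x * v) u = 0" if "u \<in> U" "v \<in> V" for u v
    using that by (force simp: inner_mult_vec_left intro: span_base)
  have "x * v = 0" if "v \<in> V" for v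
  proof -
    have "orthogonal (x * v) (x * v)"
      by (rule orthogonal_to_span[of _ U]) (use assms(1) orth that in \<open>auto simp: orthogonal_def\<close>)
    then show ?thesis
      by (simp add: orthogonal_def)
  qed
  then have "x $ k = 0" for k
    using nonzero[of k] by (auto simp: vec_eq_iff)
  with \<open>x \<noteq> 0\<close> show False
    by (simp add: vec_eq_iff)
qed

lemma span_imp_component_nonzero:
  fixes U :: "(real ^ 'n::finite) set"
  assumes "span U = UNIV"
  shows "\<exists>u\<in>U. u $ k \<noteq> 0"
proof (rule ccontr)
  assume "\<not> ?thesis"
  then have "span U \<subseteq> {x. x $ k = 0}"
    by (intro span_minimal) (auto simp: subspace_def)
  moreover have "axis k 1 \<notin> {x :: real ^ 'n. x $ k = 0}"
    by simp
  ultimately show False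
    using assms by blast
qed

lemma SCP_diagonal_pos:
  fixes B :: "('m::finite, 'n::finite) tensor"
  assumes "B \<in> SCP"
  shows "0 < diagonal_entry B k"
proof -
  obtain p :: nat and v where v: "\<forall>l\<in>{1..p}. v l \<in> nonneg_orthant"
    and B: "B = (\<Sum>l=1..p. tensor_power (v l))" and "span (v ` {1..p}) = UNIV"
    using SCP_E[OF assms] .
  then obtain l where l: "l \<in> {1..p}" "v l $ k \<noteq> 0"
    using span_imp_component_nonzero[of "v ` {1..p}" k] by blast
  have nonneg: "0 \<le> v j $ k" if "j \<in> {1..p}" for j
    using v that by (simp add: nonneg_orthant_def)
  have "0 < (\<Sum>j=1..p. (v j $ k) ^ CARD('m))"
    by (rule sum_pos2[OF _ l(1)]) (use l nonneg in \<open>auto simp: less_le\<close>)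
  then show ?thesis
    by (simp add: B diagonal_entry_sum_tensor_power)
qed

lemma CP_hadamard:
  assumes "A \<in> CP" and "B \<in> CP"
  shows "A \<circ>\<^sub>H B \<in> CP"
proof -
  obtain p :: nat and u where u: "\<forall>j\<in>{1..p}. u j \<in> nonneg_orthant"
    and A: "A = (\<Sum>j=1..p. tensor_power (u j))"
    using CP_E[OF assms(1)] .
  obtain q :: nat and v where v: "\<forall>l\<in>{1..q}. v l \<in> nonneg_orthant"
    and B: "B = (\<Sum>l=1..q. tensor_power (v l))"
    using CP_E[OF assms(2)] .
  show ?thesis
    unfolding A B hadamard_sum_tensor_power
    by (rule CP_I) (use u v in \<open>auto intro!: nonneg_orthant_mult\<close>)
qed

lemma SCP_hadamard:
  fixes A B :: "('m::finite, 'n::finite) tensor"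
  assumes "A \<in> SCP" and "B \<in> CP" and diag: "\<And>k. diagonal_entry B k \<noteq> 0"
  shows "A \<circ>\<^sub>H B \<in> SCP"
proof -
  obtain p :: nat and u where u: "\<forall>j\<in>{1..p}. u j \<in> nonneg_orthant"
    and A: "A = (\<Sum>j=1..p. tensor_power (u j))" and span: "span (u ` {1..p}) = UNIV"
    using SCP_E[OF assms(1)] .
  obtain q :: nat and v where v: "\<forall>l\<in>{1..q}. v l \<in> nonneg_orthant"
    and B: "B = (\<Sum>l=1..q. tensor_power (v l))"
    using CP_E[OF assms(2)] .
  have "\<exists>w\<in>v ` {1..q}. w $ k \<noteq> 0" for k
  proof (rule ccontr)
    assume "\<not> ?thesis"
    then have "diagonal_entry B k = 0"
      by (simp add: B diagonal_entry_sum_tensor_power)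
    with diag show False
      by blast
  qed
  then have "span ((\<lambda>(u, v). u * v) ` (u ` {1..p} \<times> v ` {1..q})) = UNIV"
    by (rule span_componentwise_products[OF span])
  moreover have "(\<lambda>(u, v). u * v) ` (u ` {1..p} \<times> v ` {1..q})
      = (\<lambda>r. u (fst r) * v (snd r)) ` ({1..p} \<times> {1..q})"
    by force
  ultimately have "span ((\<lambda>r. u (fst r) * v (snd r)) ` ({1..p} \<times> {1..q})) = UNIV"
    by simp
  then show ?thesis
    unfolding A B hadamard_sum_tensor_power
    by (intro SCP_I) (use u v in \<open>auto intro!: nonneg_orthant_mult\<close>)
qed

theorem theorem4p2:
  fixes A B :: "('m::finite, 'n::finite) tensor"
  assumes "CARD('m) \<ge> 2" and "CARD('n) \<ge> 2"
    and "A \<in> CP" and "B \<in> CP"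
  shows "A \<circ>\<^sub>H B \<in> CP
    \<and> (A \<in> SCP \<and> (\<forall>k. diagonal_entry B k > 0) \<longrightarrow> A \<circ>\<^sub>H B \<in> SCP)
    \<and> (A \<in> SCP \<and> B \<in> SCP \<longrightarrow> A \<circ>\<^sub>H B \<in> SCP)"
proof (intro conjI impI)
  show "A \<circ>\<^sub>H B \<in> CP"
    using assms(3,4) by (rule CP_hadamard)
next
  assume "A \<in> SCP \<and> (\<forall>k. diagonal_entry B k > 0)"
  then show "A \<circ>\<^sub>H B \<in> SCP"
    using SCP_hadamard[OF _ assms(4)] by (metis less_irrefl)
next
  assume "A \<in> SCP \<and> B \<in> SCP"
  then show "A \<circ>\<^sub>H B \<in> SCP"
    using SCP_hadamard[OF _ assms(4)] SCP_diagonal_pos by (metis less_irrefl)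
qed

end
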